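(* The following statements are equivalent for every subset $A$ of $\mathbb{R}^+$. (i) The set $A$ is lower porous at $0$. (ii) The union $A\cup B$ is porous at $0$ for every strongly porous at $0$ set $B\subseteq\mathbb{R}^+$.
   Context: $\mathbb{R}^+=[0,\infty)$. For $E\subseteq\mathbb{R}^+$ and $h>0$, $\lambda(E,h)$ denotes the length of the largest open subinterval of $(0,h)$ that contains no point of $E$ (and $\lambda(E,h)=0$ if there is no such nonempty interval). The right upper porosity of $E$ at $0$ is $\overline{p}(E)=\limsup_{h\to 0^+}\frac{\lambda(E,h)}{h}$ and the right lower porosity of $E$ at $0$ is $\underline{p}(E)=\liminf_{h\to 0^+}\frac{\lambda(E,h)}{h}$. The set $E$ is porous at $0$ if $\overline{p}(E)>0$, strongly porous at $0$ if $\overline{p}(E)=1$, and lower porous at $0$ if $\underline{p}(E)>0$. *)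

theory Defs
  imports "HOL-Analysis.Analysis"
begin

text \<open>
  Degenerate intervals (with \<open>a = b\<close>) are admitted, so that the value is \<open>0\<close> when no nonempty
  open subinterval of \<open>(0, h)\<close> misses \<open>E\<close>. The supremum is a maximum: see
  \<open>gap_length_attained\<close> below. Only \<open>h > 0\<close> is relevant.
\<close>

definition gap_length :: "real set \<Rightarrow> real \<Rightarrow> real" where
  "gap_length E h = Sup {b - a | a b. 0 \<le> a \<and> a \<le> b \<and> b \<le> h \<and> {a<..<b} \<inter> E = {}}"

definition upper_porosity :: "real set \<Rightarrow> ereal" where
  "upper_porosity E = Limsup (at_right 0) (\<lambda>h. ereal (gap_length E h / h))"

definition lower_porosity :: "real set \<Rightarrow> ereal" where
  "lower_porosity E = Liminf (at_right 0) (\<lambda>h. ereal (gap_length E h / h))"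

definition porous_at_0 :: "real set \<Rightarrow> bool" where
  "porous_at_0 E \<longleftrightarrow> upper_porosity E > 0"

definition strongly_porous_at_0 :: "real set \<Rightarrow> bool" where
  "strongly_porous_at_0 E \<longleftrightarrow> upper_porosity E = 1"

definition lower_porous_at_0 :: "real set \<Rightarrow> bool" where
  "lower_porous_at_0 E \<longleftrightarrow> lower_porosity E > 0"

lemma gap_length_attained:
  assumes "h > 0"
  shows "\<exists>a b. 0 \<le> a \<and> a \<le> b \<and> b \<le> h \<and> {a<..<b} \<inter> E = {} \<and> gap_length E h = b - a"
    and "\<And>a b. 0 \<le> a \<Longrightarrow> a \<le> b \<Longrightarrow> b \<le> h \<Longrightarrow> {a<..<b} \<inter> E = {} \<Longrightarrow> b - a \<le> gap_length E h"
proof -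
  let ?S = "{p :: real \<times> real. 0 \<le> fst p \<and> fst p \<le> snd p \<and> snd p \<le> h} \<inter>
    (\<Inter>x\<in>E. {p. x \<le> fst p} \<union> {p. snd p \<le> x})"
  let ?f = "\<lambda>p :: real \<times> real. snd p - fst p"
  have S: "p \<in> ?S \<longleftrightarrow> 0 \<le> fst p \<and> fst p \<le> snd p \<and> snd p \<le> h \<and> {fst p<..<snd p} \<inter> E = {}" for p
    by force
  have "closed ?S"
    by (intro closed_Int closed_INT ballI closed_Un closed_Collect_conj closed_Collect_le continuous_intros)
  moreover have "bounded ?S"
    by (rule bounded_subset[of "{0..h} \<times> {0..h}"]) (auto intro: bounded_Times)
  ultimately have compact: "compact ?S"
    by (simp add: compact_eq_bounded_closed)
  have "(0, 0) \<in> ?S"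
    using assms by (simp add: S del: Int_iff)
  then have "?S \<noteq> {}"
    by blast
  moreover have "continuous_on ?S ?f"
    by (intro continuous_intros)
  ultimately have "\<exists>p\<in>?S. \<forall>q\<in>?S. ?f q \<le> ?f p"
    by (rule continuous_attains_sup[OF compact])
  then obtain p where p: "p \<in> ?S" "\<And>q. q \<in> ?S \<Longrightarrow> ?f q \<le> ?f p"
    by blast
  have le: "b - a \<le> ?f p" if "0 \<le> a" "a \<le> b" "b \<le> h" "{a<..<b} \<inter> E = {}" for a b
    using p(2)[of "(a, b)"] that S[of "(a, b)"] by simp
  have p': "0 \<le> fst p" "fst p \<le> snd p" "snd p \<le> h" "{fst p<..<snd p} \<inter> E = {}"
    using p(1) unfolding S by blast+
  have eq: "gap_length E h = ?f p"
    unfolding gap_length_def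
  proof (rule cSup_eq_maximum)
    show "?f p \<in> {b - a | a b. 0 \<le> a \<and> a \<le> b \<and> b \<le> h \<and> {a<..<b} \<inter> E = {}}"
      using p' by blast
  qed (use le in blast)
  show "\<exists>a b. 0 \<le> a \<and> a \<le> b \<and> b \<le> h \<and> {a<..<b} \<inter> E = {} \<and> gap_length E h = b - a"
    using p' eq by blast
  show "b - a \<le> gap_length E h" if "0 \<le> a" "a \<le> b" "b \<le> h" "{a<..<b} \<inter> E = {}" for a b
    using le[OF that] eq by simp
qed

end

theory Submission imports Defs begin

text \<open>
  Suppose that for all small \<open>h\<close> the set \<open>A\<close> has a gap of length at least \<open>c h\<close> in \<open>(0, h)\<close>, and
  let \<open>B\<close> be strongly porous at \<open>0\<close>. There are arbitrarily small \<open>h\<close> for which \<open>B\<close> misses almost all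
  of \<open>(0, h)\<close>, in the shape of an interval \<open>(a, b)\<close> with \<open>a\<close> much smaller than \<open>c h\<close> and \<open>b\<close> close
  to \<open>h\<close>. The large gap of \<open>A\<close> in \<open>(0, b)\<close> loses at most the length \<open>a\<close> when it is cut down to
  \<open>(a, b)\<close>, and what remains is a gap of \<open>A \<union> B\<close> of length comparable to \<open>h\<close>
  (\<open>porous_Un_if_lower_porous\<close>).

  Conversely, if \<open>A\<close> is not lower porous at \<open>0\<close>, there are scales \<open>h\<^sub>0 > h\<^sub>1 > \<dots>\<close> tending to \<open>0\<close> such
  that the gaps of \<open>A\<close> in \<open>(0, h\<^sub>n)\<close> are shorter than \<open>h\<^sub>n / (n + 1)\<^sup>2\<close>. On
  \<open>(0, h\<^sub>0)\<close> let \<open>B\<close> leave free exactly the windows \<open>(h\<^sub>n / (n + 1), h\<^sub>n)\<close>, so that \<open>B\<close> is strongly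
  porous at \<open>0\<close>. A gap of \<open>A \<union> B\<close> near \<open>0\<close> lies in one of these windows; its length is less than
  \<open>h\<^sub>n / (n + 1)\<^sup>2\<close>, while its distance from \<open>0\<close> is at least \<open>h\<^sub>n / (n + 1)\<close>.
  Relative to its position it is therefore shorter than \<open>1 / (n + 1)\<close>, and
  \<open>A \<union> B\<close> is not porous at \<open>0\<close>. The point of the construction is that the window can be long
  relative to \<open>h\<^sub>n\<close> and yet start far above the length of the gaps of \<open>A\<close>
  (\<open>ex_strongly_porous_not_porous_Un\<close>).
\<close>

lemma gap_length_le:
  assumes "h > 0"
  shows "gap_length E h \<le> h"
proof -
  obtain a b where "0 \<le> a" "b \<le> h" "gap_length E h = b - a"
    using gap_length_attained(1)[OF assms] by blast
  then show ?thesis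
    by linarith
qed

lemma frequently_at_right_0:
  "(\<exists>\<^sub>F h in at_right (0::real). P h) \<longleftrightarrow> (\<forall>\<eta>>0. \<exists>h. 0 < h \<and> h < \<eta> \<and> P h)"
  unfolding frequently_def eventually_at_right_field by blast

lemma lower_porous_at_0_iff:
  "lower_porous_at_0 E \<longleftrightarrow> (\<exists>c>0. \<exists>\<delta>>0. \<forall>h. 0 < h \<and> h < \<delta> \<longrightarrow> c * h \<le> gap_length E h)"
proof -
  let ?f = "\<lambda>h. ereal (gap_length E h / h)"
  have "lower_porous_at_0 E \<longleftrightarrow> (\<exists>c>0. \<forall>\<^sub>F h in at_right 0. ereal c \<le> ?f h)"
  proof
    assume "lower_porous_at_0 E"
    then have "0 < Liminf (at_right 0) ?f"
      by (simp add: lower_porous_at_0_def lower_porosity_def)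
    then obtain c where c: "0 < ereal c" "ereal c < Liminf (at_right 0) ?f"
      using ereal_dense2 by blast
    have "\<forall>\<^sub>F h in at_right 0. ereal c \<le> ?f h"
      using less_LiminfD[OF c(2)] by (rule eventually_mono) (rule less_imp_le)
    then show "\<exists>c>0. \<forall>\<^sub>F h in at_right 0. ereal c \<le> ?f h"
      using c(1) by auto
  next
    assume "\<exists>c>0. \<forall>\<^sub>F h in at_right 0. ereal c \<le> ?f h"
    then obtain c where c: "c > 0" "\<forall>\<^sub>F h in at_right 0. ereal c \<le> ?f h"
      by blast
    have "ereal 0 < ereal c"
      using c(1) by simp
    also have "\<dots> \<le> Liminf (at_right 0) ?f"
      by (rule Liminf_bounded[OF c(2)])
    finally show "lower_porous_at_0 E"
      by (simp add: lower_porous_at_0_def lower_porosity_def zero_ereal_def)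
  qed
  then show ?thesis
    by (simp add: eventually_at_right_field pos_le_divide_eq) blast
qed

lemma porous_at_0_iff:
  "porous_at_0 E \<longleftrightarrow> (\<exists>c>0. \<forall>\<eta>>0. \<exists>h. 0 < h \<and> h < \<eta> \<and> c * h \<le> gap_length E h)"
proof -
  let ?f = "\<lambda>h. ereal (gap_length E h / h)"
  have "porous_at_0 E \<longleftrightarrow> (\<exists>c>0. \<exists>\<^sub>F h in at_right 0. ereal c \<le> ?f h)"
  proof
    assume "porous_at_0 E"
    then have "\<not> Limsup (at_right 0) ?f \<le> 0"
      by (simp add: porous_at_0_def upper_porosity_def not_le)
    then obtain y where y: "y > 0" "\<not> (\<forall>\<^sub>F h in at_right 0. y > ?f h)"
      unfolding Limsup_le_iff by blast
    then obtain c where c: "0 < ereal c" "ereal c < y"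
      using ereal_dense2 by blast
    have "\<exists>\<^sub>F h in at_right 0. y \<le> ?f h"
      using y(2) by (simp add: frequently_def not_le)
    then have "\<exists>\<^sub>F h in at_right 0. ereal c \<le> ?f h"
      by (rule frequently_elim1) (use c(2) in \<open>meson less_imp_le order_trans\<close>)
    then show "\<exists>c>0. \<exists>\<^sub>F h in at_right 0. ereal c \<le> ?f h"
      using c(1) by auto
  next
    assume "\<exists>c>0. \<exists>\<^sub>F h in at_right 0. ereal c \<le> ?f h"
    then obtain c where c: "c > 0" "\<exists>\<^sub>F h in at_right 0. ereal c \<le> ?f h"
      by blast
    have "\<not> Limsup (at_right 0) ?f < ereal c"
      using Limsup_lessD[of "at_right 0" ?f "ereal c"] c(2) by (auto simp: frequently_def not_le)
    moreover have "0 < ereal c"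
      using c(1) by simp
    ultimately show "porous_at_0 E"
      unfolding porous_at_0_def upper_porosity_def by (meson not_less order_less_le_trans)
  qed
  also have "\<dots> \<longleftrightarrow> (\<exists>c>0. \<forall>\<eta>>0. \<exists>h. 0 < h \<and> h < \<eta> \<and> c * h \<le> gap_length E h)"
    unfolding frequently_at_right_0 by (simp add: pos_le_divide_eq cong: conj_cong)
  finally show ?thesis .
qed

lemma strongly_porous_at_0_iff:
  "strongly_porous_at_0 E \<longleftrightarrow>
    (\<forall>c<1. \<forall>\<eta>>0. \<exists>h. 0 < h \<and> h < \<eta> \<and> c * h < gap_length E h)"
proof -
  let ?f = "\<lambda>h. ereal (gap_length E h / h)"
  have "\<forall>\<^sub>F h in at_right 0. ?f h \<le> ereal 1"
    unfolding eventually_at_right_field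
    by (intro exI[of _ 1]) (simp add: gap_length_le)
  from Limsup_bounded[OF this] have le1: "Limsup (at_right 0) ?f \<le> 1"
    by (simp add: one_ereal_def)
  have "strongly_porous_at_0 E \<longleftrightarrow> (\<forall>c<1. \<exists>\<^sub>F h in at_right 0. ereal c < ?f h)"
  proof (intro iffI allI impI)
    fix c :: real
    assume E: "strongly_porous_at_0 E" and c: "c < 1"
    show "\<exists>\<^sub>F h in at_right 0. ereal c < ?f h"
    proof (rule ccontr)
      assume "\<not> ?thesis"
      then have "\<forall>\<^sub>F h in at_right 0. ?f h \<le> ereal c"
        by (simp add: frequently_def not_less)
      from Limsup_bounded[OF this] have "1 \<le> ereal c"
        using E by (simp add: strongly_porous_at_0_def upper_porosity_def)
      then show False
        using c by simp
    qed
  next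
    assume *: "\<forall>c<1. \<exists>\<^sub>F h in at_right 0. ereal c < ?f h"
    have "\<not> Limsup (at_right 0) ?f < 1"
    proof
      assume "Limsup (at_right 0) ?f < 1"
      then obtain c where c: "Limsup (at_right 0) ?f < ereal c" "ereal c < 1"
        using ereal_dense2 by blast
      have "\<forall>\<^sub>F h in at_right 0. \<not> ereal c < ?f h"
        using Limsup_lessD[OF c(1)] by (rule eventually_mono) (rule less_not_sym)
      then show False
        using * c(2) by (simp add: frequently_def)
    qed
    then show "strongly_porous_at_0 E"
      using le1 by (simp add: strongly_porous_at_0_def upper_porosity_def)
  qed
  also have "\<dots> \<longleftrightarrow> (\<forall>c<1. \<forall>\<eta>>0. \<exists>h. 0 < h \<and> h < \<eta> \<and> c * h < gap_length E h)"
    unfolding frequently_at_right_0 by (simp add: pos_less_divide_eq cong: conj_cong)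
  finally show ?thesis .
qed

text \<open>
  The gap of \<open>A\<close> has to be taken in \<open>(0, b)\<close>, where \<open>(a, b)\<close> is a gap of \<open>B\<close> that nearly fills
  \<open>(0, h)\<close>: then it can stick out of \<open>(a, b)\<close> only on the left.
\<close>

lemma porous_Un_if_lower_porous:
  assumes "lower_porous_at_0 A" and "strongly_porous_at_0 B"
  shows "porous_at_0 (A \<union> B)"
proof -
  obtain c0 \<delta> where c0: "c0 > 0" and \<delta>: "\<delta> > 0"
    and gapA: "\<And>h. 0 < h \<Longrightarrow> h < \<delta> \<Longrightarrow> c0 * h \<le> gap_length A h"
    using assms(1) unfolding lower_porous_at_0_iff by blast
  define c where "c = min c0 1"
  have c: "0 < c" "c \<le> 1" "c \<le> c0"
    using c0 by (auto simp: c_def)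
  have "\<exists>h. 0 < h \<and> h < \<eta> \<and> c / 2 * h \<le> gap_length (A \<union> B) h" if "\<eta> > 0" for \<eta>
  proof -
    \<comment> \<open>A relative error of \<open>c / 4\<close> leaves a gap of length \<open>c (1 - c / 4) h - c h / 4 \<ge> c h / 2\<close>.\<close>
    have "1 - c / 4 < 1" "min \<eta> \<delta> > 0"
      using c \<open>\<eta> > 0\<close> \<delta> by auto
    then obtain h where h: "0 < h" "h < min \<eta> \<delta>" "(1 - c / 4) * h < gap_length B h"
      using assms(2) unfolding strongly_porous_at_0_iff by blast
    obtain a b where ab: "0 \<le> a" "a \<le> b" "b \<le> h" "{a<..<b} \<inter> B = {}" "gap_length B h = b - a"
      using gap_length_attained(1)[OF h(1)] by blast
    have ch: "c * h \<le> h"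
      using c h(1) by simp
    have big: "h - c * h / 4 < b - a"
      using h(3) ab(5) by (simp add: algebra_simps)
    then have "0 < b"
      using ab(1) ch h(1) by linarith
    then obtain u v where uv: "0 \<le> u" "u \<le> v" "v \<le> b" "{u<..<v} \<inter> A = {}" "gap_length A b = v - u"
      using gap_length_attained(1) by blast
    have "c * b \<le> c0 * b"
      using c \<open>0 < b\<close> by simp
    also have "\<dots> \<le> v - u"
      using gapA[of b] uv(5) \<open>0 < b\<close> ab(3) h(2) by simp
    finally have "c * b \<le> v - u" .
    moreover have "c * (h - c * h / 4) \<le> c * b"
      using big ab(1) c(1) by (intro mult_left_mono) auto
    moreover have "c * (c * h) \<le> c * h"
      using ch c(1) by (intro mult_left_mono) auto
    ultimately have "c * h * 3 / 4 \<le> v - u"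
      by (simp add: algebra_simps)
    moreover have "a < c * h / 4"
      using big ab(3) by linarith
    ultimately have len: "c / 2 * h \<le> v - max u a"
      using uv(1) mult_pos_pos[OF c(1) h(1)] by (auto simp: max_def)
    have "v - max u a \<le> gap_length (A \<union> B) h"
    proof (rule gap_length_attained(2)[OF h(1)])
      show "max u a \<le> v"
        using len c(1) h(1) by (smt (verit) divide_pos_pos mult_pos_pos)
      show "{max u a<..<v} \<inter> (A \<union> B) = {}"
        using uv(3,4) ab(4) by fastforce
    qed (use uv ab in auto)
    then show ?thesis
      using len h by force
  qed
  then show ?thesis
    unfolding porous_at_0_iff using c(1) by (intro exI[of _ "c / 2"]) simp
qed

text \<open>
  The scales drop fast enough (\<open>h (Suc n) < h n / Suc n\<close>) for the windows \<open>{h n / Suc n<..<h n}\<close>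
  to be separated by nondegenerate intervals, so that a gap cannot extend over two windows.
\<close>

lemma not_lower_porous_scales:
  assumes "\<not> lower_porous_at_0 A"
  obtains h :: "nat \<Rightarrow> real" where "\<And>n. 0 < h n" "\<And>n. h n < 1 / Suc n"
    "\<And>n. gap_length A (h n) < h n / (Suc n)\<^sup>2" "\<And>n. h (Suc n) < h n / Suc n"
proof -
  have small: "\<exists>t. 0 < t \<and> t < \<delta> \<and> gap_length A t < c * t" if "c > 0" "\<delta> > 0" for c \<delta>
    using assms that unfolding lower_porous_at_0_iff by (meson not_le)
  have ex: "\<exists>t. 0 < t \<and> t < \<delta> \<and> t < 1 / Suc n \<and> gap_length A t < t / (Suc n)\<^sup>2"
    if "\<delta> > 0" for \<delta> n
    using small[of "1 / (Suc n)\<^sup>2" "min \<delta> (1 / Suc n)"] that by auto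
  have "\<exists>h. \<forall>n. (0 < h n \<and> h n < 1 / Suc n \<and> gap_length A (h n) < h n / (Suc n)\<^sup>2) \<and>
    h (Suc n) < h n / Suc n"
  proof (rule dependent_nat_choice)
    show "\<exists>t. 0 < t \<and> t < 1 / Suc 0 \<and> gap_length A t < t / (Suc 0)\<^sup>2"
      using ex[of 1 0] by auto
    show "\<exists>t. (0 < t \<and> t < 1 / Suc (Suc n) \<and> gap_length A t < t / (Suc (Suc n))\<^sup>2) \<and>
        t < s / Suc n"
      if "0 < s \<and> s < 1 / Suc n \<and> gap_length A s < s / (Suc n)\<^sup>2" for s n
      using ex[of "s / Suc n" "Suc n"] that by auto
  qed
  then show ?thesis
    using that by blast
qed

text \<open>
  Only the behaviour near \<open>0\<close> matters, so \<open>B\<close> may be left empty above \<open>h 0\<close>.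
\<close>

lemma ex_strongly_porous_not_porous_Un:
  assumes "\<not> lower_porous_at_0 A"
  obtains B where "B \<subseteq> {0..}" "strongly_porous_at_0 B" "\<not> porous_at_0 (A \<union> B)"
proof -
  obtain h :: "nat \<Rightarrow> real" where pos: "\<And>n. 0 < h n" and small: "\<And>n. h n < 1 / Suc n"
    and gapA: "\<And>n. gap_length A (h n) < h n / (Suc n)\<^sup>2"
    and step: "\<And>n. h (Suc n) < h n / Suc n"
    using not_lower_porous_scales[OF assms] by blast
  define s where "s n = h n / Suc n" for n
  have s_pos: "0 < s n" and s_le: "s n \<le> h n" for n
    using pos[of n] by (simp_all add: s_def field_simps)
  have step': "h (Suc n) < s n" for n
    using step by (simp add: s_def)
  have "decseq h"
    by (rule decseq_SucI) (use step' s_le in \<open>meson less_imp_le order_trans\<close>)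
  have "decseq s"
    by (rule decseq_SucI) (use step' s_le in \<open>meson less_imp_le order_trans\<close>)
  have tends: "\<exists>N. h N < \<epsilon> \<and> 1 / Suc N < \<epsilon>" if "\<epsilon> > 0" for \<epsilon>
    using reals_Archimedean[OF that] small order_less_trans
    by (metis inverse_eq_divide)
  define B where "B = (\<Union>n. {h (Suc n)..s n})"
  have B_nonneg: "B \<subseteq> {0..}"
    unfolding B_def using order_trans[OF less_imp_le[OF pos]] by fastforce
  have window: "{s n<..<h n} \<inter> B = {}" for n
  proof -
    have "x \<notin> {h (Suc m)..s m}" if "s n < x" "x < h n" for x m
    proof (cases "m < n")
      case True
      then have "h n \<le> h (Suc m)"
        using \<open>decseq h\<close> by (simp add: decseq_def)
      then show ?thesis
        using that by simp
    next
      case False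
      then have "s m \<le> s n"
        using \<open>decseq s\<close> by (simp add: decseq_def)
      then show ?thesis
        using that by simp
    qed
    then show ?thesis
      unfolding B_def by auto
  qed
  have "strongly_porous_at_0 B"
    unfolding strongly_porous_at_0_iff
  proof (intro allI impI)
    fix c \<eta> :: real
    assume "c < 1" "\<eta> > 0"
    then obtain N where N: "h N < min \<eta> (1 - c)" "1 / Suc N < min \<eta> (1 - c)"
      using tends[of "min \<eta> (1 - c)"] by auto
    have "c * h N < (1 - 1 / Suc N) * h N"
      using N(2) pos[of N] by (intro mult_strict_right_mono) auto
    also have "\<dots> = h N - s N"
      by (simp add: s_def algebra_simps)
    also have "\<dots> \<le> gap_length B (h N)"
      using gap_length_attained(2)[OF pos[of N], of "s N" "h N" B] window s_le
        s_pos[of N] by simp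
    finally show "\<exists>h. 0 < h \<and> h < \<eta> \<and> c * h < gap_length B h"
      using N(1) pos by auto
  qed
  moreover have "\<not> porous_at_0 (A \<union> B)"
    unfolding porous_at_0_iff
  proof (intro notI, elim exE conjE)
    fix c :: real
    assume "c > 0" and *: "\<forall>\<eta>>0. \<exists>t. 0 < t \<and> t < \<eta> \<and> c * t \<le> gap_length (A \<union> B) t"
    obtain N where N: "1 / Suc N < c"
      using tends[OF \<open>c > 0\<close>] by blast
    obtain t where t: "0 < t" "t < s N" "c * t \<le> gap_length (A \<union> B) t"
      using * s_pos[of N] by blast
    obtain a b where ab: "0 \<le> a" "a \<le> b" "b \<le> t" "{a<..<b} \<inter> (A \<union> B) = {}"
      "gap_length (A \<union> B) t = b - a"
      using gap_length_attained(1)[OF t(1)] by blast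
    have "0 < c * t"
      using \<open>c > 0\<close> t(1) by simp
    then have "a < b"
      using t(3) ab(5) by linarith
    then obtain x where x: "a < x" "x < b"
      using dense by blast
    \<comment> \<open>The window that contains \<open>x\<close> is found from the first scale that is at most \<open>x\<close>.\<close>
    define m where "m = (LEAST m. h m \<le> x)"
    obtain M where M: "h M < x"
      using tends[of x] x(1) ab(1) by auto
    have m: "h m \<le> x" "\<And>k. k < m \<Longrightarrow> x < h k"
      unfolding m_def using LeastI[of "\<lambda>m. h m \<le> x" M] M not_less_Least not_le by auto
    have xN: "x < s N"
      using x(2) ab(3) t(2) by simp
    have "m \<noteq> 0"
    proof
      assume "m = 0"
      then have "h 0 \<le> x"
        using m(1) by simp
      moreover have "h N \<le> h 0"
        using \<open>decseq h\<close> by (simp add: decseq_def)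
      ultimately show False
        using xN s_le[of N] by linarith
    qed
    then obtain n where n: "m = Suc n"
      using not0_implies_Suc by blast
    have "x < h n" "h (Suc n) \<le> x"
      using m n by auto
    moreover have "x \<notin> B"
      using ab(4) x by auto
    ultimately have "s n < x"
      unfolding B_def by force
    have "N < n"
    proof (rule ccontr)
      assume "\<not> N < n"
      then have "s N \<le> s n"
        using \<open>decseq s\<close> by (simp add: decseq_def)
      then show False
        using \<open>s n < x\<close> xN by linarith
    qed
    then obtain k where k: "n = Suc k"
      by (cases n) auto
    have "h n \<in> B"
      unfolding B_def k using step'[of k] by (auto intro!: exI[of _ k])
    then have "h n \<notin> {a<..<b}"
      using ab(4) by auto
    then have "b \<le> h n"
      using x(1) \<open>x < h n\<close> by auto
    then have "b - a \<le> gap_length A (h n)"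
      using gap_length_attained(2)[OF pos] ab by blast
    also have "\<dots> < s n / Suc n"
      using gapA[of n] by (simp add: s_def power2_eq_square algebra_simps)
    also have "\<dots> \<le> t / Suc n"
      using \<open>s n < x\<close> x(2) ab(3) by (intro divide_right_mono) auto
    also have "\<dots> \<le> c * t"
    proof -
      have "1 / real (Suc n) \<le> 1 / Suc N"
        using \<open>N < n\<close> by (simp add: frac_le)
      then have "1 / Suc n * t \<le> c * t"
        using N t(1) by (intro mult_right_mono) auto
      then show ?thesis
        by simp
    qed
    finally show False
      using t(3) ab(5) by simp
  qed
  ultimately show ?thesis
    using that B_nonneg by blast
qed

theorem theorem4p10:
  fixes A :: "real set"
  assumes "A \<subseteq> {0..}"
  shows "lower_porous_at_0 A \<longleftrightarrow>
    (\<forall>B. B \<subseteq> {0..} \<longrightarrow> strongly_porous_at_0 B \<longrightarrow> porous_at_0 (A \<union> B))"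
  using porous_Un_if_lower_porous ex_strongly_porous_not_porous_Un by metis

end
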